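(* Let $k \geq 3$ be an integer. If the edge Folkman number $F_e(K_{k+1},K_{k+1}; J_{k+2})$ exists, then the vertex Folkman number $F_v(K_k,K_k;J_{k+1})$ exists.
   Context: All graphs are finite, undirected and simple. $K_n$ is the complete graph on $n$ vertices and $J_n = K_n - e$ is $K_n$ with one edge removed. A graph $G$ is $H$-free if it contains no subgraph isomorphic to $H$. For graphs $G, H_1, H_2$: $G \rightarrow (H_1,H_2)^v$ means that every red-blue coloring of the vertices of $G$ contains a red copy of $H_1$ or a blue copy of $H_2$ (as subgraphs induced on monochromatic vertex sets); $G \rightarrow (H_1,H_2)^e$ means that every red-blue coloring of the edges of $G$ contains a red subgraph isomorphic to $H_1$ or a blue subgraph isomorphic to $H_2$. The vertex Folkman number $F_v(H_1,H_2;H)$ is the smallest $n$ such that there is an $H$-free graph $G$ on $n$ vertices with $G \rightarrow (H_1,H_2)^v$; the edge Folkman number $F_e(H_1,H_2;H)$ is defined analogously with $G \rightarrow (H_1,H_2)^e$. Such a number "exists" if at least one such $H$-free graph exists. *)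

theory Defs
  imports Main
begin

datatype 'a ugraph = Graph (verts: "'a set") (edges: "'a set set")

text \<open>Edges are two-element vertex sets, so graphs are undirected, without loops and without
  multiple edges.\<close>

definition simple_graph :: "'a ugraph \<Rightarrow> bool" where
  "simple_graph G \<longleftrightarrow>
     finite (verts G) \<and> (\<forall>e\<in>edges G. e \<subseteq> verts G \<and> card e = 2)"

definition subgraph :: "'a ugraph \<Rightarrow> 'a ugraph \<Rightarrow> bool" where
  "subgraph G' G \<longleftrightarrow>
     simple_graph G' \<and> verts G' \<subseteq> verts G \<and> edges G' \<subseteq> edges G"

definition isomorphic :: "'a ugraph \<Rightarrow> 'b ugraph \<Rightarrow> bool" where
  "isomorphic G H \<longleftrightarrow>
     (\<exists>f. bij_betw f (verts G) (verts H) \<and> (\<lambda>e. f ` e) ` edges G = edges H)"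

definition contains_copy :: "'a ugraph \<Rightarrow> 'b ugraph \<Rightarrow> bool" where
  "contains_copy G H \<longleftrightarrow> (\<exists>G'. subgraph G' G \<and> isomorphic G' H)"

abbreviation free_of :: "'a ugraph \<Rightarrow> 'b ugraph \<Rightarrow> bool" where
  "free_of G H \<equiv> \<not> contains_copy G H"

definition complete_graph :: "nat \<Rightarrow> nat ugraph" where
  "complete_graph n = Graph {..<n} {e. e \<subseteq> {..<n} \<and> card e = 2}"

text \<open>The choice of the removed edge is immaterial up to isomorphism. The edge \<open>{0, 1}\<close> is
  present in \<open>complete_graph n\<close> only for \<open>n \<ge> 2\<close>.\<close>

definition almost_complete_graph :: "nat \<Rightarrow> nat ugraph" where
  "almost_complete_graph n =
     Graph (verts (complete_graph n)) (edges (complete_graph n) - {{0, 1}})"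

definition induced_subgraph :: "'a ugraph \<Rightarrow> 'a set \<Rightarrow> 'a ugraph" where
  "induced_subgraph G W = Graph (verts G \<inter> W) {e \<in> edges G. e \<subseteq> W}"

datatype colour = Red | Blue

text \<open>Colourings are total functions; only their values on the vertices (edges) of the graph
  matter.\<close>

definition vertex_arrows :: "'a ugraph \<Rightarrow> 'b ugraph \<Rightarrow> 'c ugraph \<Rightarrow> bool" where
  "vertex_arrows G H1 H2 \<longleftrightarrow>
     (\<forall>c :: 'a \<Rightarrow> colour.
        contains_copy (induced_subgraph G {v \<in> verts G. c v = Red}) H1 \<or>
        contains_copy (induced_subgraph G {v \<in> verts G. c v = Blue}) H2)"

definition edge_arrows :: "'a ugraph \<Rightarrow> 'b ugraph \<Rightarrow> 'c ugraph \<Rightarrow> bool" where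
  "edge_arrows G H1 H2 \<longleftrightarrow>
     (\<forall>c :: 'a set \<Rightarrow> colour.
        contains_copy (Graph (verts G) {e \<in> edges G. c e = Red}) H1 \<or>
        contains_copy (Graph (verts G) {e \<in> edges G. c e = Blue}) H2)"

text \<open>The orders of the graphs over which the Folkman numbers minimise. Every finite graph is
  isomorphic to one with vertices in \<^typ>\<open>nat\<close>, so fixing this vertex type loses no orders.\<close>

definition vertex_folkman_orders :: "'a ugraph \<Rightarrow> 'b ugraph \<Rightarrow> 'c ugraph \<Rightarrow> nat set" where
  "vertex_folkman_orders H1 H2 H =
     {card (verts G) | G :: nat ugraph. simple_graph G \<and> free_of G H \<and> vertex_arrows G H1 H2}"

definition edge_folkman_orders :: "'a ugraph \<Rightarrow> 'b ugraph \<Rightarrow> 'c ugraph \<Rightarrow> nat set" where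
  "edge_folkman_orders H1 H2 H =
     {card (verts G) | G :: nat ugraph. simple_graph G \<and> free_of G H \<and> edge_arrows G H1 H2}"

text \<open>A Folkman number is a relation rather than a function, because it need not exist.\<close>

definition is_vertex_folkman_number ::
    "'a ugraph \<Rightarrow> 'b ugraph \<Rightarrow> 'c ugraph \<Rightarrow> nat \<Rightarrow> bool" where
  "is_vertex_folkman_number H1 H2 H n \<longleftrightarrow>
     n \<in> vertex_folkman_orders H1 H2 H \<and> (\<forall>m \<in> vertex_folkman_orders H1 H2 H. n \<le> m)"

definition is_edge_folkman_number ::
    "'a ugraph \<Rightarrow> 'b ugraph \<Rightarrow> 'c ugraph \<Rightarrow> nat \<Rightarrow> bool" where
  "is_edge_folkman_number H1 H2 H n \<longleftrightarrow>
     n \<in> edge_folkman_orders H1 H2 H \<and> (\<forall>m \<in> edge_folkman_orders H1 H2 H. n \<le> m)"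

definition vertex_folkman_number_exists ::
    "'a ugraph \<Rightarrow> 'b ugraph \<Rightarrow> 'c ugraph \<Rightarrow> bool" where
  "vertex_folkman_number_exists H1 H2 H \<longleftrightarrow> vertex_folkman_orders H1 H2 H \<noteq> {}"

definition edge_folkman_number_exists ::
    "'a ugraph \<Rightarrow> 'b ugraph \<Rightarrow> 'c ugraph \<Rightarrow> bool" where
  "edge_folkman_number_exists H1 H2 H \<longleftrightarrow> edge_folkman_orders H1 H2 H \<noteq> {}"

lemma nonempty_has_least_nat: "n \<in> A \<Longrightarrow> \<exists>n::nat. n \<in> A \<and> (\<forall>m\<in>A. n \<le> m)"
  by (rule exI[of _ "LEAST n. n \<in> A"]) (auto intro: LeastI Least_le)

lemma vertex_folkman_number_exists_iff:
  "vertex_folkman_number_exists H1 H2 H \<longleftrightarrow> (\<exists>n. is_vertex_folkman_number H1 H2 H n)"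
  unfolding vertex_folkman_number_exists_def is_vertex_folkman_number_def
  using nonempty_has_least_nat by (metis ex_in_conv)

lemma edge_folkman_number_exists_iff:
  "edge_folkman_number_exists H1 H2 H \<longleftrightarrow> (\<exists>n. is_edge_folkman_number H1 H2 H n)"
  unfolding edge_folkman_number_exists_def is_edge_folkman_number_def
  using nonempty_has_least_nat by (metis ex_in_conv)

end

theory Submission
  imports Defs
begin

text \<open>Suppose no neighbourhood in an edge Folkman graph \<open>G\<close> arrows \<open>(K\<^sub>k, K\<^sub>k)\<close>, and
  fix a bad vertex colouring of each. Order the vertices and give an edge the colour that the
  neighbourhood of its smaller end assigns to its larger end. The smallest vertex of a monochromatic
  \<open>K\<^bsub>k+1\<^esub>\<close> then sees a monochromatic \<open>K\<^sub>k\<close> in its neighbourhood, a contradiction. So some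
  neighbourhood arrows, and it is \<open>J\<^bsub>k+1\<^esub>\<close>-free because joining a vertex to \<open>J\<^bsub>k+1\<^esub>\<close>
  yields \<open>J\<^bsub>k+2\<^esub>\<close>.\<close>

text \<open>This is the open neighbourhood: \<open>{v, v}\<close> is a singleton, so in a simple
  graph \<open>v\<close> itself is left out.\<close>

definition neighbourhood :: "'a ugraph \<Rightarrow> 'a \<Rightarrow> 'a ugraph" where
  "neighbourhood G v = induced_subgraph G {w \<in> verts G. {v, w} \<in> edges G}"

lemma simple_induced_subgraph: "simple_graph G \<Longrightarrow> simple_graph (induced_subgraph G W)"
  by (auto simp: simple_graph_def induced_subgraph_def)

lemma simple_almost_complete_graph: "simple_graph (almost_complete_graph n)"
  by (auto simp: simple_graph_def almost_complete_graph_def complete_graph_def)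

text \<open>Copies need not be induced, so an injective map that preserves edges in one direction is
  enough. Later arguments build such maps instead of subgraphs with isomorphisms.\<close>

lemma contains_copy_iff_embedding:
  assumes "simple_graph H"
  shows "contains_copy G H \<longleftrightarrow>
    (\<exists>f. inj_on f (verts H) \<and> f ` verts H \<subseteq> verts G \<and> (\<forall>e\<in>edges H. f ` e \<in> edges G))"
    (is "?L \<longleftrightarrow> ?R")
proof
  assume ?L
  then obtain G' g where G': "subgraph G' G" and g: "bij_betw g (verts G') (verts H)"
    and edges: "(\<lambda>e. g ` e) ` edges G' = edges H"
    unfolding contains_copy_def isomorphic_def by blast
  define f where "f = inv_into (verts G') g"
  have f: "bij_betw f (verts H) (verts G')"
    unfolding f_def using g by (rule bij_betw_inv_into)
  have "f ` e \<in> edges G" if "e \<in> edges H" for e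
  proof -
    from that obtain e' where e': "e' \<in> edges G'" "e = g ` e'"
      unfolding edges[symmetric] by (rule imageE)
    then have "e' \<subseteq> verts G'" using G' unfolding subgraph_def simple_graph_def by blast
    then have "f ` e = e'"
      unfolding e' f_def using g by (simp add: bij_betw_def inv_into_image_cancel)
    then show ?thesis using e' G' unfolding subgraph_def by blast
  qed
  moreover have "f ` verts H \<subseteq> verts G"
    using f G' unfolding subgraph_def by (simp add: bij_betw_def)
  ultimately show ?R using f unfolding bij_betw_def by (intro exI[of _ f]) simp
next
  assume ?R
  then obtain f where f: "inj_on f (verts H)" "f ` verts H \<subseteq> verts G"
    and edges: "\<forall>e\<in>edges H. f ` e \<in> edges G" by blast
  define G' where "G' = Graph (f ` verts H) ((\<lambda>e. f ` e) ` edges H)"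
  have sub: "e \<subseteq> verts H" "card e = 2" if "e \<in> edges H" for e
    using that assms unfolding simple_graph_def by simp_all
  have "card (f ` e) = 2" if "e \<in> edges H" for e
    using card_image[OF inj_on_subset[OF f(1) sub(1)[OF that]]] sub(2)[OF that] by simp
  then have "simple_graph G'"
    using assms image_mono[OF sub(1), of _ f] unfolding simple_graph_def G'_def by simp
  then have "subgraph G' G"
    using f(2) edges unfolding subgraph_def G'_def by auto
  moreover have "isomorphic G' H"
    unfolding isomorphic_def
  proof (intro exI conjI)
    show "bij_betw (inv_into (verts H) f) (verts G') (verts H)"
      unfolding G'_def using f(1) by (simp add: bij_betw_inv_into inj_on_imp_bij_betw)
    have "inv_into (verts H) f ` f ` e = e" if "e \<in> edges H" for e
      using f(1) sub(1)[OF that] by (rule inv_into_image_cancel)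
    then show "(\<lambda>e. inv_into (verts H) f ` e) ` edges G' = edges H"
      unfolding G'_def by (simp add: image_image)
  qed
  ultimately show ?L unfolding contains_copy_def by blast
qed

text \<open>All pairs are edges, so the labelling of a copy is irrelevant and any bijection from
  \<open>{..<n}\<close> onto a clique is an embedding. \<open>G\<close> is arbitrary here, which
  lets the lemma apply directly to colour classes.\<close>

lemma contains_complete_graph_iff:
  "contains_copy G (complete_graph n) \<longleftrightarrow>
    (\<exists>S\<subseteq>verts G. finite S \<and> card S = n \<and> (\<forall>x\<in>S. \<forall>y\<in>S. x \<noteq> y \<longrightarrow> {x, y} \<in> edges G))"
    (is "?L \<longleftrightarrow> ?R")
proof -
  have simple: "simple_graph (complete_graph n)"
    by (auto simp: simple_graph_def complete_graph_def)
  show ?thesis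
  proof
    assume ?L
    then obtain f where f: "inj_on f {..<n}" "f ` {..<n} \<subseteq> verts G"
      and edges: "\<And>e. e \<subseteq> {..<n} \<Longrightarrow> card e = 2 \<Longrightarrow> f ` e \<in> edges G"
      unfolding contains_copy_iff_embedding[OF simple] by (auto simp: complete_graph_def)
    have "{f i, f j} \<in> edges G" if "i < n" "j < n" "f i \<noteq> f j" for i j
    proof -
      have "card {i, j} = 2" using that by (auto simp: card_2_iff)
      then show ?thesis using edges[of "{i, j}"] that by simp
    qed
    then show ?R
      using f by (intro exI[of _ "f ` {..<n}"]) (auto simp: card_image)
  next
    assume ?R
    then obtain S where S: "S \<subseteq> verts G" "finite S" "card S = n"
      and edges: "\<And>x y. x \<in> S \<Longrightarrow> y \<in> S \<Longrightarrow> x \<noteq> y \<Longrightarrow> {x, y} \<in> edges G" by blast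
    obtain f where f: "bij_betw f {..<n} S"
      using S by (metis card_lessThan finite_lessThan finite_same_card_bij)
    have "f ` e \<in> edges G" if "e \<subseteq> {..<n}" "card e = 2" for e
    proof -
      from that obtain i j where "e = {i, j}" "i \<noteq> j" by (auto simp: card_2_iff)
      then show ?thesis
        using that f edges[of "f i" "f j"] by (auto simp: bij_betw_def inj_on_def)
    qed
    then show ?L
      using f S(1) unfolding contains_copy_iff_embedding[OF simple]
      by (intro exI[of _ f]) (auto simp: complete_graph_def bij_betw_def)
  qed
qed

text \<open>Adding \<open>v\<close> as the new vertex \<open>n\<close> extends an embedding: all
  pairs containing \<open>n\<close> go to edges at \<open>v\<close>, and the missing pair is still
  \<open>{0, 1}\<close>.\<close>

lemma neighbourhood_almost_complete_free:
  assumes G: "simple_graph G" "v \<in> verts G"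
    and free: "free_of G (almost_complete_graph (Suc n))"
    and n: "n \<ge> 2"
  shows "free_of (neighbourhood G v) (almost_complete_graph n)"
proof
  assume "contains_copy (neighbourhood G v) (almost_complete_graph n)"
  then obtain f where f: "inj_on f {..<n}"
    and sub: "f ` {..<n} \<subseteq> {w \<in> verts G. {v, w} \<in> edges G}"
    and all: "\<forall>e\<in>{e. e \<subseteq> {..<n} \<and> card e = 2} - {{0, 1}}. f ` e \<in> edges G"
    unfolding contains_copy_iff_embedding[OF simple_almost_complete_graph]
    by (auto simp: almost_complete_graph_def complete_graph_def neighbourhood_def
        induced_subgraph_def)
  have nbr: "f i \<in> verts G \<and> {v, f i} \<in> edges G" if "i < n" for i
    using sub that by blast
  have edges: "f ` e \<in> edges G" if "e \<subseteq> {..<n}" "card e = 2" "e \<noteq> {0, 1}" for e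
    using all that by blast
  define g where "g = f(n := v)"
  \<comment> \<open>Otherwise \<open>{v, f i}\<close> would be an edge with a single
    element.\<close>
  have ne: "f i \<noteq> v" if "i < n" for i
    using nbr[OF that] G(1) unfolding simple_graph_def by force
  have "inj_on g {..<Suc n}"
    using f ne unfolding g_def inj_on_def by (auto simp: less_Suc_eq dest: ne ne[symmetric])
  moreover have "g ` {..<Suc n} \<subseteq> verts G"
    using nbr G(2) unfolding g_def by (auto simp: less_Suc_eq)
  moreover have "g ` e \<in> edges G" if e: "e \<subseteq> {..<Suc n}" "card e = 2" "e \<noteq> {0, 1}" for e
  proof (cases "n \<in> e")
    case True
    with e(2) obtain i where i: "e = {n, i}" "i \<noteq> n" by (auto simp: card_2_iff)
    then have "g ` e = {v, f i}" unfolding g_def by auto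
    then show ?thesis using i e(1) nbr[of i] by simp
  next
    case False
    then have "e \<subseteq> {..<n}" using e(1) by (auto simp: less_Suc_eq)
    moreover have "g ` e = f ` e" using False unfolding g_def by auto
    ultimately show ?thesis using edges e by simp
  qed
  ultimately have "contains_copy G (almost_complete_graph (Suc n))"
    unfolding contains_copy_iff_embedding[OF simple_almost_complete_graph]
    by (intro exI[of _ g]) (auto simp: almost_complete_graph_def complete_graph_def)
  with free show False by blast
qed

text \<open>At the least vertex \<open>v\<close> of the clique, \<open>Min {v, w} = v\<close> and
  \<open>Max {v, w} = w\<close>, so the colour of the edge to \<open>w\<close> is the colour
  \<open>col v w\<close> of the vertex \<open>w\<close>. Leaving \<open>a\<close> open covers both
  colours at once.\<close>

lemma monochromatic_clique_in_neighbourhood: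
  fixes G :: "'a::linorder ugraph" and col :: "'a \<Rightarrow> 'a \<Rightarrow> colour"
  assumes "contains_copy (Graph (verts G) {e \<in> edges G. col (Min e) (Max e) = a})
    (complete_graph (Suc k))"
  shows "\<exists>v\<in>verts G. contains_copy
    (induced_subgraph (neighbourhood G v) {w \<in> verts (neighbourhood G v). col v w = a})
    (complete_graph k)"
proof -
  from assms obtain S where S: "S \<subseteq> verts G" "finite S" "card S = Suc k"
    and edges: "\<And>x y. x \<in> S \<Longrightarrow> y \<in> S \<Longrightarrow> x \<noteq> y \<Longrightarrow>
      {x, y} \<in> edges G \<and> col (Min {x, y}) (Max {x, y}) = a"
    unfolding contains_complete_graph_iff by auto
  define v where "v = Min S"
  have v: "v \<in> S" unfolding v_def using S by (intro Min_in) auto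
  have nbr: "{v, w} \<in> edges G \<and> col v w = a" if "w \<in> S - {v}" for w
  proof -
    have "v \<le> w" unfolding v_def using S that by simp
    then show ?thesis using edges[of v w] v that by (auto simp: min_def max_def)
  qed
  have "card (S - {v}) = k" using S v by simp
  then have "contains_copy
    (induced_subgraph (neighbourhood G v) {w \<in> verts (neighbourhood G v). col v w = a})
    (complete_graph k)"
    \<comment> \<open>Edges avoiding \<open>v\<close> matter only as edges of \<open>G\<close>;
      their own colours come from other neighbourhoods and are dropped.\<close>
    unfolding contains_complete_graph_iff
    using S nbr edges
    by (intro exI[of _ "S - {v}"])
      (auto simp: neighbourhood_def induced_subgraph_def)
  then show ?thesis using v S by blast
qed

lemma edge_arrows_imp_neighbourhood_vertex_arrows:
  fixes G :: "'a::linorder ugraph"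
  assumes "edge_arrows G (complete_graph (Suc k)) (complete_graph (Suc l))"
  shows "\<exists>v\<in>verts G. vertex_arrows (neighbourhood G v) (complete_graph k) (complete_graph l)"
proof (rule ccontr)
  assume "\<not> ?thesis"
  then have "\<forall>v\<in>verts G. \<exists>c.
      free_of (induced_subgraph (neighbourhood G v)
        {w \<in> verts (neighbourhood G v). c w = Red}) (complete_graph k) \<and>
      free_of (induced_subgraph (neighbourhood G v)
        {w \<in> verts (neighbourhood G v). c w = Blue}) (complete_graph l)"
    unfolding vertex_arrows_def by simp
  \<comment> \<open>Choice merges the bad colourings of all neighbourhoods into one function of two
    vertices, from which a single edge colouring can be read off.\<close>
  from bchoice[OF this] obtain col where col: "\<forall>v\<in>verts G.
      free_of (induced_subgraph (neighbourhood G v)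
        {w \<in> verts (neighbourhood G v). col v w = Red}) (complete_graph k) \<and>
      free_of (induced_subgraph (neighbourhood G v)
        {w \<in> verts (neighbourhood G v). col v w = Blue}) (complete_graph l)"
    by (rule exE)
  from assms[unfolded edge_arrows_def, rule_format, of "\<lambda>e. col (Min e) (Max e)"]
  show False
  proof
    assume "contains_copy (Graph (verts G) {e \<in> edges G. col (Min e) (Max e) = Red})
      (complete_graph (Suc k))"
    from monochromatic_clique_in_neighbourhood[OF this] col show False by simp
  next
    assume "contains_copy (Graph (verts G) {e \<in> edges G. col (Min e) (Max e) = Blue})
      (complete_graph (Suc l))"
    from monochromatic_clique_in_neighbourhood[OF this] col show False by simp
  qed
qed

theorem theorem2:
  fixes k :: nat
  assumes "k \<ge> 3"
    and "edge_folkman_number_exists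
           (complete_graph (k + 1)) (complete_graph (k + 1)) (almost_complete_graph (k + 2))"
  shows "vertex_folkman_number_exists
           (complete_graph k) (complete_graph k) (almost_complete_graph (k + 1))"
proof -
  from assms(2) obtain G :: "nat ugraph" where G: "simple_graph G"
    "free_of G (almost_complete_graph (k + 2))"
    "edge_arrows G (complete_graph (k + 1)) (complete_graph (k + 1))"
    unfolding edge_folkman_number_exists_def edge_folkman_orders_def by blast
  \<comment> \<open>The linear order used to orient the edges is that of the natural
    numbers.\<close>
  then obtain v where v: "v \<in> verts G"
    "vertex_arrows (neighbourhood G v) (complete_graph k) (complete_graph k)"
    using edge_arrows_imp_neighbourhood_vertex_arrows[of G k k] by auto
  have "simple_graph (neighbourhood G v)"
    unfolding neighbourhood_def using G(1) by (rule simple_induced_subgraph)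
  moreover have "free_of (neighbourhood G v) (almost_complete_graph (k + 1))"
    using neighbourhood_almost_complete_free[OF G(1) v(1), of "k + 1"] G(2) assms(1) by simp
  ultimately show ?thesis
    using v(2) unfolding vertex_folkman_number_exists_def vertex_folkman_orders_def by blast
qed

end
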